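(* Let $(X,p)$ be a multiplicative metric space and let $d_p:X\times X\to[0,+\infty)$ be the metric $d_p(x,y)=\ln(p(x,y))$. A sequence $\{x_n\}$ in $X$ is a multiplicative Cauchy sequence in $(X,p)$ if and only if $\{x_n\}$ is a Cauchy sequence in the metric space $(X,d_p)$.
   Context: A multiplicative metric space is a pair $(X,p)$ where $X$ is a nonempty set and $p:X\times X\to[1,+\infty)$ is a function such that for all $x,y,z\in X$: (1) $p(x,y)\ge 1$, and $x=y$ if and only if $p(x,y)=1$; (2) $p(x,y)=p(y,x)$; (3) $p(x,z)\le p(x,y)\,p(y,z)$. The function $d_p=\ln p$ is a metric on $X$. A sequence $\{x_n\}$ in a multiplicative metric space $(X,p)$ is a multiplicative Cauchy sequence if for every $\epsilon>1$ there exists $N\in\mathbb{N}$ such that $p(x_n,x_m)<\epsilon$ for all $m,n\ge N$. *)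

theory Defs
  imports "HOL-Analysis.Analysis"
begin

(* All axioms are relativised to the carrier X; values of p outside X are irrelevant. *)
locale multiplicative_metric_space =
  fixes X :: "'a set" and p :: "'a \<Rightarrow> 'a \<Rightarrow> real"
  assumes nonempty: "X \<noteq> {}"
    and ge_one: "\<lbrakk>x \<in> X; y \<in> X\<rbrakk> \<Longrightarrow> 1 \<le> p x y"
    and eq_iff: "\<lbrakk>x \<in> X; y \<in> X\<rbrakk> \<Longrightarrow> x = y \<longleftrightarrow> p x y = 1"
    and sym: "\<lbrakk>x \<in> X; y \<in> X\<rbrakk> \<Longrightarrow> p x y = p y x"
    and mult_triangle: "\<lbrakk>x \<in> X; y \<in> X; z \<in> X\<rbrakk> \<Longrightarrow> p x z \<le> p x y * p y z"
begin

definition mult_Cauchy :: "(nat \<Rightarrow> 'a) \<Rightarrow> bool" where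
  "mult_Cauchy x \<longleftrightarrow>
     range x \<subseteq> X \<and> (\<forall>\<epsilon>>1. \<exists>N. \<forall>m n. N \<le> m \<longrightarrow> N \<le> n \<longrightarrow> p (x n) (x m) < \<epsilon>)"

(* Metric_space demands symmetry and nonnegativity on the whole type, not only on the
   carrier, so ln p is extended by 0 outside X. *)
definition log_dist :: "'a \<Rightarrow> 'a \<Rightarrow> real" where
  "log_dist x y = (if x \<in> X \<and> y \<in> X then ln (p x y) else 0)"

lemma Metric_space_log_dist: "Metric_space X log_dist"
proof
  fix x y
  show "0 \<le> log_dist x y"
    by (simp add: log_dist_def ge_one)
  show "log_dist x y = log_dist y x"
    by (simp add: log_dist_def sym)
next
  fix x y
  assume xy: "x \<in> X" "y \<in> X"
  have "0 < p x y"
    using ge_one[OF xy] by simp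
  then show "log_dist x y = 0 \<longleftrightarrow> x = y"
    using xy eq_iff[OF xy] by (simp add: log_dist_def)
next
  fix x y z
  assume xyz: "x \<in> X" "y \<in> X" "z \<in> X"
  have pos: "0 < p x y" "0 < p y z" "0 < p x z"
    using ge_one[of x y] ge_one[of y z] ge_one[of x z] xyz by auto
  have "ln (p x z) \<le> ln (p x y * p y z)"
    using pos mult_triangle[OF xyz] by (simp add: ln_mono)
  also have "\<dots> = ln (p x y) + ln (p y z)"
    using pos by (simp add: ln_mult)
  finally show "log_dist x z \<le> log_dist x y + log_dist y z"
    using xyz by (simp add: log_dist_def)
qed

end

end

theory Submission
  imports Defs
begin

text \<open>
  The exponential is an increasing bijection from the positive reals onto \<open>{1<..}\<close>, with
  inverse the logarithm. Hence the multiplicative ball of radius \<open>exp e\<close> about a point is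
  exactly the ball of radius \<open>e\<close> for the logarithmic distance (\<open>log_dist_less_iff\<close>), and the two Cauchy conditions
  turn into one another when the tolerances are matched by \<open>\<epsilon> = exp e\<close>, with the same
  threshold \<open>N\<close> on both sides.
\<close>

lemma (in multiplicative_metric_space) log_dist_less_iff:
  assumes "x \<in> X" and "y \<in> X"
  shows "log_dist x y < e \<longleftrightarrow> p x y < exp e"
proof -
  have "0 < p x y"
    using ge_one[OF assms] by simp
  then have "p x y < exp e \<longleftrightarrow> ln (p x y) < ln (exp e)"
    by (intro ln_less_cancel_iff [symmetric]) simp_all
  then show ?thesis
    using assms by (simp add: log_dist_def)
qed

theorem theorem5:
  fixes X :: "'a set" and p :: "'a \<Rightarrow> 'a \<Rightarrow> real" and x :: "nat \<Rightarrow> 'a"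
  assumes "multiplicative_metric_space X p"
    and "range x \<subseteq> X"
  shows "multiplicative_metric_space.mult_Cauchy X p x \<longleftrightarrow>
         Metric_space.MCauchy X (multiplicative_metric_space.log_dist X p) x"
proof -
  interpret multiplicative_metric_space X p by (fact assms(1))
  interpret L: Metric_space X log_dist by (fact Metric_space_log_dist)
  have x_in: "x n \<in> X" for n
    using assms(2) by blast
  show ?thesis
  proof
    assume C: "mult_Cauchy x"
    have "\<exists>N. \<forall>m n. N \<le> m \<longrightarrow> N \<le> n \<longrightarrow> log_dist (x m) (x n) < e" if "0 < e" for e
    proof -
      have "1 < exp e"
        using that by simp
      then obtain N where N: "\<forall>m n. N \<le> m \<longrightarrow> N \<le> n \<longrightarrow> p (x n) (x m) < exp e"
        using C unfolding mult_Cauchy_def by blast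
      then show ?thesis
        using x_in by (auto simp: log_dist_less_iff)
    qed
    then show "L.MCauchy x"
      unfolding L.MCauchy_def using assms(2) by blast
  next
    assume C: "L.MCauchy x"
    have "\<exists>N. \<forall>m n. N \<le> m \<longrightarrow> N \<le> n \<longrightarrow> p (x n) (x m) < \<epsilon>" if "1 < \<epsilon>" for \<epsilon>
    proof -
      have "0 < ln \<epsilon>" and exp_ln: "exp (ln \<epsilon>) = \<epsilon>"
        using that by simp_all
      then obtain N where "\<forall>m n. N \<le> m \<longrightarrow> N \<le> n \<longrightarrow> log_dist (x m) (x n) < ln \<epsilon>"
        using C unfolding L.MCauchy_def by blast
      then show ?thesis
        using x_in by (auto simp: log_dist_less_iff exp_ln)
    qed
    then show "mult_Cauchy x"
      unfolding mult_Cauchy_def using assms(2) by blast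
  qed
qed

end
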